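(* Let $q$ be a power of $2$. Then for all $b,c,d\in\mathbb{F}_{q^2}$, the polynomial $x^{q+1}+bx^q+cx+d\in\mathbb{F}_{q^2}[x]$ is not a permutation polynomial of $\mathbb{F}_{q^2}$.
   Context: $\mathbb{F}_{q^2}$ is the finite field with $q^2$ elements. A polynomial over $\mathbb{F}_{q^2}$ is a permutation polynomial of $\mathbb{F}_{q^2}$ if it induces a bijection of $\mathbb{F}_{q^2}$ onto itself. *)

theory Defs
  imports "HOL-Computational_Algebra.Polynomial" "HOL-Library.Cardinality"
begin

definition permutation_poly :: "'a::{field,finite} poly \<Rightarrow> bool" where
  "permutation_poly p \<longleftrightarrow> bij (poly p)"

end

theory Submission imports Defs
begin

text \<open>
  This is an instance of Hermite's criterion: over a finite field with \<open>n\<close> elements, a polynomial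
  whose degree exceeds 1 and divides \<open>n - 1\<close> never permutes the field. The tool is the sum over
  all field elements, which on polynomials of degree at most \<open>n - 1\<close> sees only the coefficient of
  \<open>x^(n - 1)\<close> (lemma \<open>sum_poly_UNIV\<close>). If \<open>f\<close> has degree \<open>e\<close> with \<open>e * m = n - 1\<close>, then \<open>f^m\<close>
  has degree exactly \<open>n - 1\<close>, so its values have a nonzero sum. Were \<open>f\<close> a permutation, this sum
  would equal the sum of all \<open>y^m\<close>, which vanishes because \<open>m < n - 1\<close>.

  In the theorem \<open>n = q^2\<close> and the degree is \<open>q + 1\<close>, a divisor of \<open>q^2 - 1 = (q + 1) * (q - 1)\<close>.
\<close>

lemma of_nat_CARD_eq_0: "of_nat CARD('a) = (0 :: 'a::{field,finite})"
proof -
  \<comment> \<open>Translation by 1 permutes the field and adds 1 to each of the \<open>CARD('a)\<close> summands.\<close>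
  have "(\<Sum>x\<in>(UNIV::'a set). x) = (\<Sum>x\<in>UNIV. x + 1)"
    by (rule sum.reindex_bij_witness[of _ "\<lambda>x. x + 1" "\<lambda>x. x - 1"]) auto
  also have "\<dots> = (\<Sum>x\<in>(UNIV::'a set). x) + of_nat CARD('a)"
    by (simp add: sum.distrib)
  finally show ?thesis by simp
qed

lemma CARD_field_ge_2: "CARD('a::{field,finite}) \<ge> 2"
proof -
  have "card {0, 1 :: 'a} \<le> CARD('a)"
    by (rule card_mono) auto
  then show ?thesis by simp
qed

text \<open>
  Multiplication by \<open>a\<close> permutes the nonzero elements, so their product \<open>P\<close> satisfies
  \<open>P = a^(n - 1) * P\<close>, and \<open>P\<close> cancels.
\<close>
lemma power_CARD_minus_1:
  fixes a :: "'a::{field,finite}"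
  assumes "a \<noteq> 0"
  shows "a ^ (CARD('a) - 1) = 1"
proof -
  let ?P = "\<Prod>x\<in>UNIV - {0::'a}. x"
  have "?P = (\<Prod>x\<in>UNIV - {0::'a}. a * x)"
    using assms
    by (intro prod.reindex_bij_witness[of _ "\<lambda>x. a * x" "\<lambda>x. x / a"]) auto
  also have "\<dots> = a ^ (CARD('a) - 1) * ?P"
    by (simp add: prod.distrib card_Diff_singleton)
  finally show ?thesis by simp
qed

text \<open>
  The nonzero elements outnumber the roots of \<open>x^j - 1\<close>, so some nonzero \<open>a\<close> has \<open>a^j \<noteq> 1\<close>.
  Scaling the summation variable by \<open>a\<close> multiplies the power sum by \<open>a^j\<close> without changing it.
\<close>
lemma sum_power_UNIV_eq_0:
  assumes "j < CARD('a) - 1"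
  shows "(\<Sum>x\<in>(UNIV::'a::{field,finite} set). x ^ j) = 0"
proof (cases "j = 0")
  case True
  then show ?thesis by (simp add: of_nat_CARD_eq_0)
next
  case False
  let ?p = "monom 1 j - 1 :: 'a poly"
  have coeff: "coeff ?p j = 1"
    using False by simp
  then have "?p \<noteq> 0" by force
  moreover have "degree ?p \<le> j"
    by (rule degree_le) (auto simp: coeff_eq_0)
  ultimately have "card {x. poly ?p x = 0} \<le> j"
    using card_poly_roots_bound[of ?p] by linarith
  moreover have "card (UNIV - {0::'a}) = CARD('a) - 1"
    by (simp add: card_Diff_singleton)
  ultimately have "\<not> UNIV - {0} \<subseteq> {x. poly ?p x = 0}"
    using assms card_mono[of "{x. poly ?p x = 0}" "UNIV - {0}"] by fastforce
  then obtain a :: 'a where a: "a \<noteq> 0" "a ^ j \<noteq> 1"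
    by (auto simp: poly_monom)
  let ?S = "\<Sum>x\<in>(UNIV::'a set). x ^ j"
  have "?S = (\<Sum>x\<in>(UNIV::'a set). (a * x) ^ j)"
    using a by (intro sum.reindex_bij_witness[of _ "\<lambda>x. a * x" "\<lambda>x. x / a"]) auto
  also have "\<dots> = a ^ j * ?S"
    by (simp add: power_mult_distrib sum_distrib_left)
  finally show ?thesis using a by simp
qed

lemma sum_power_CARD_minus_1:
  "(\<Sum>x\<in>(UNIV::'a::{field,finite} set). x ^ (CARD('a) - 1)) = - 1"
proof -
  have "(\<Sum>x\<in>(UNIV::'a set). x ^ (CARD('a) - 1)) = (\<Sum>x\<in>UNIV - {0::'a}. x ^ (CARD('a) - 1))"
    using CARD_field_ge_2[where 'a = 'a] by (intro sum.mono_neutral_right) auto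
  also have "\<dots> = (\<Sum>x\<in>UNIV - {0::'a}. 1)"
    by (intro sum.cong refl power_CARD_minus_1) simp
  also have "\<dots> = of_nat (CARD('a) - 1)"
    by (simp add: card_Diff_singleton)
  also have "\<dots> = - 1"
    using CARD_field_ge_2[where 'a = 'a] by (subst of_nat_diff) (auto simp: of_nat_CARD_eq_0)
  finally show ?thesis .
qed

lemma sum_poly_UNIV:
  fixes p :: "'a::{field,finite} poly"
  assumes "degree p \<le> CARD('a) - 1"
  shows "(\<Sum>x\<in>UNIV. poly p x) = - coeff p (CARD('a) - 1)"
proof -
  let ?N = "CARD('a) - 1"
  have "(\<Sum>x\<in>UNIV. poly p x) = (\<Sum>x\<in>UNIV. \<Sum>i\<le>?N. coeff p i * x ^ i)"
    unfolding poly_altdef using assms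
    by (intro sum.cong refl sum.mono_neutral_left) (auto simp: coeff_eq_0)
  also have "\<dots> = (\<Sum>i\<le>?N. coeff p i * (\<Sum>x\<in>(UNIV::'a set). x ^ i))"
    by (subst sum.swap) (simp add: sum_distrib_left)
  also have "\<dots> = (\<Sum>i\<in>{?N}. coeff p i * (\<Sum>x\<in>(UNIV::'a set). x ^ i))"
    by (intro sum.mono_neutral_right) (auto simp: sum_power_UNIV_eq_0)
  also have "\<dots> = - coeff p ?N"
    using sum_power_CARD_minus_1[where 'a = 'a] by simp
  finally show ?thesis .
qed

text \<open>
  Comparing two evaluations of the sum of \<open>f(x)^m\<close>, with \<open>m = (CARD('a) - 1) / degree f\<close>: minus the
  leading coefficient of \<open>f^m\<close> on the one hand, a vanishing power sum after substituting
  \<open>y = f(x)\<close> on the other.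
\<close>
theorem not_permutation_poly_degree_dvd:
  fixes f :: "'a::{field,finite} poly"
  assumes "degree f > 1" and "degree f dvd CARD('a) - 1"
  shows "\<not> permutation_poly f"
proof
  assume "permutation_poly f"
  then have bij: "bij (poly f)"
    by (simp add: permutation_poly_def)
  obtain m where m: "CARD('a) - 1 = degree f * m"
    using assms(2) by (elim dvdE)
  have deg: "degree (f ^ m) = CARD('a) - 1"
    using assms(1) m by (subst degree_power_eq) auto
  have "m > 0"
    using m CARD_field_ge_2[where 'a = 'a] by (cases m) auto
  then have "m < CARD('a) - 1"
    using m assms(1) by simp
  then have "0 = (\<Sum>y\<in>(UNIV::'a set). y ^ m)"
    by (simp add: sum_power_UNIV_eq_0)
  also have "\<dots> = (\<Sum>x\<in>UNIV. poly f x ^ m)"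
    using sum.reindex_bij_betw[OF bij, of "\<lambda>y. y ^ m"] by simp
  also have "\<dots> = (\<Sum>x\<in>UNIV. poly (f ^ m) x)"
    by simp
  also have "\<dots> = - coeff (f ^ m) (CARD('a) - 1)"
    by (rule sum_poly_UNIV) (simp only: deg order.refl)
  also have "\<dots> = - (lead_coeff f ^ m)"
    by (simp only: lead_coeff_power flip: deg)
  finally show False
    using assms(1) by auto
qed

theorem theorem3p8:
  fixes q :: nat and b c d :: "'a::{field,finite}"
  assumes q_power_of_2: "\<exists>k\<ge>1. q = 2 ^ k"
    and card_field: "CARD('a) = q ^ 2"
  shows "\<not> permutation_poly (monom 1 (q + 1) + monom b q + monom c 1 + [:d:])"
proof (rule not_permutation_poly_degree_dvd)
  let ?f = "monom 1 (q + 1) + monom b q + monom c 1 + [:d:]"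
  have "q > 0"
    using q_power_of_2 by auto
  have degree: "degree ?f = q + 1"
  proof (rule antisym)
    show "degree ?f \<le> q + 1"
      by (intro degree_add_le order.trans[OF degree_monom_le]) auto
    have "coeff ?f (q + 1) = 1"
      using \<open>q > 0\<close> by simp
    then show "q + 1 \<le> degree ?f"
      by (intro le_degree) simp
  qed
  show "degree ?f > 1"
    using degree \<open>q > 0\<close> by simp
  have "CARD('a) - 1 = (q + 1) * (q - 1)"
    using card_field \<open>q > 0\<close> by (cases q) (auto simp: power2_eq_square)
  then show "degree ?f dvd CARD('a) - 1"
    by (simp only: degree dvd_triv_left)
qed

end
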